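(* Let $n_1,\dots,n_k$ be odd positive integers and let $v:\Gamma\times\Gamma\to\mathbb{T}$ be a symmetric bicharacter on $\Gamma=\mathbb{Z}_{n_1}\times\cdots\times\mathbb{Z}_{n_k}$. Then for all $\chi,\eta\in\Delta_v$, either $v(\chi,\eta)=1$ or $v_S(\chi,\eta)\neq1$.
   Context: A bicharacter on an abelian group $\Gamma$ is a map $v:\Gamma\times\Gamma\to\mathbb{T}$ that is a character in each variable separately; it is symmetric if $v(\chi,\eta)=v(\eta,\chi)$ for all $\chi,\eta$. Set $v_S(\chi,\eta)=v(\chi,\eta)v(\eta,\chi)$ and $\Delta_v=\{\chi\in\Gamma:v(\chi,\chi)=1\}$. *)

theory Defs
  imports Complex_Main "HOL-Algebra.Elementary_Groups" "HOL-Algebra.Product_Groups"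
begin

definition circle_group :: "complex monoid" where
  "circle_group = \<lparr>carrier = {z. cmod z = 1}, monoid.mult = (*), one = 1\<rparr>"

lemma comm_group_circle_group: "comm_group circle_group"
proof (rule comm_groupI)
  fix z assume z: "z \<in> carrier circle_group"
  show "\<exists>w \<in> carrier circle_group. w \<otimes>\<^bsub>circle_group\<^esub> z = \<one>\<^bsub>circle_group\<^esub>"
    using z by (intro bexI[of _ "inverse z"]) (auto simp: circle_group_def norm_inverse intro!: left_inverse)
qed (auto simp: circle_group_def norm_mult)

definition bicharacter :: "('a, 'b) monoid_scheme \<Rightarrow> ('a \<Rightarrow> 'a \<Rightarrow> complex) \<Rightarrow> bool" where
  "bicharacter \<Gamma> v \<longleftrightarrow>
     (\<forall>\<chi> \<in> carrier \<Gamma>. (\<lambda>\<eta>. v \<chi> \<eta>) \<in> hom \<Gamma> circle_group) \<and>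
     (\<forall>\<eta> \<in> carrier \<Gamma>. (\<lambda>\<chi>. v \<chi> \<eta>) \<in> hom \<Gamma> circle_group)"

definition symmetric_bicharacter :: "('a, 'b) monoid_scheme \<Rightarrow> ('a \<Rightarrow> 'a \<Rightarrow> complex) \<Rightarrow> bool" where
  "symmetric_bicharacter \<Gamma> v \<longleftrightarrow>
     bicharacter \<Gamma> v \<and> (\<forall>\<chi> \<in> carrier \<Gamma>. \<forall>\<eta> \<in> carrier \<Gamma>. v \<chi> \<eta> = v \<eta> \<chi>)"

definition bichar_sym :: "('a \<Rightarrow> 'a \<Rightarrow> complex) \<Rightarrow> 'a \<Rightarrow> 'a \<Rightarrow> complex" where
  "bichar_sym v \<chi> \<eta> = v \<chi> \<eta> * v \<eta> \<chi>"

definition bichar_Delta :: "('a, 'b) monoid_scheme \<Rightarrow> ('a \<Rightarrow> 'a \<Rightarrow> complex) \<Rightarrow> 'a set" where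
  "bichar_Delta \<Gamma> v = {\<chi> \<in> carrier \<Gamma>. v \<chi> \<chi> = 1}"

text \<open>The group \<open>\<int>\<^bsub>n 1\<^esub> \<times> \<dots> \<times> \<int>\<^bsub>n k\<^esub>\<close>, written additively in each factor. Pitfall:
  \<^const>\<open>integer_mod_group\<close> at \<open>0\<close> is the infinite group \<open>\<int>\<close>, so positivity of the \<open>n i\<close>
  matters; for \<open>k = 0\<close> the product is trivial.\<close>

definition cyclic_product :: "nat \<Rightarrow> (nat \<Rightarrow> nat) \<Rightarrow> (nat \<Rightarrow> int) monoid" where
  "cyclic_product k n = product_group {1..k} (\<lambda>i. integer_mod_group (n i))"

lemma comm_group_cyclic_product: "comm_group (cyclic_product k n)"
  unfolding cyclic_product_def
proof (rule group.group_comm_groupI)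
  show "group (product_group {1..k} (\<lambda>i. integer_mod_group (n i)))"
    by simp
qed (auto intro!: restrict_ext simp: add.commute)

end

(* If v(chi,eta)^2 = 1, then v(chi,eta) = 1 or -1; it is also a root of unity of odd order
   because Gamma has odd order, so it is 1. *)
theory Submission
  imports Defs "HOL-Algebra.Multiplicative_Group"
begin

text \<open>By symmetry \<open>bichar_sym v \<chi> \<eta>\<close> is the square of
  \<open>v \<chi> \<eta>\<close>, so it suffices that -1 is never a value of the character
  \<open>v \<chi>\<close>. That is Lagrange's theorem in a group of odd order
  (\<open>hom_circle_group_eq_1_if_odd_order\<close>); the order here is a product of odd numbers
  (\<open>order_cyclic_product\<close>).\<close>

lemma nat_pow_circle_group: "z [^]\<^bsub>circle_group\<^esub> (m::nat) = z ^ m"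
  by (induction m) (auto simp: nat_pow_def circle_group_def)

lemma order_cyclic_product:
  assumes "\<And>i. i \<in> {1..k} \<Longrightarrow> n i > 0"
  shows "order (cyclic_product k n) = (\<Prod>i\<in>{1..k}. n i)"
proof -
  have "card (carrier (integer_mod_group (n i))) = n i" if "i \<in> {1..k}" for i
    using assms[OF that] by (simp add: carrier_integer_mod_group)
  then show ?thesis
    by (simp add: order_def cyclic_product_def carrier_product_group card_PiE)
qed

text \<open>Lagrange forces \<open>h x ^ order G = 1\<close>, which -1 violates for an odd exponent.
  Oddness also encodes finiteness, as \<open>order\<close> is 0 for infinite groups.\<close>

lemma hom_circle_group_eq_1_if_odd_order:
  assumes "group G" and "odd (order G)" and "h \<in> hom G circle_group" and "x \<in> carrier G"
    and "h x * h x = 1"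
  shows "h x = 1"
proof -
  interpret group_hom G circle_group h
    using assms(1,3) comm_group_circle_group
    by (simp add: group_hom_def group_hom_axioms_def comm_group_def)
  have "h x ^ order G = h (x [^]\<^bsub>G\<^esub> order G)"
    using assms(4) by (simp add: hom_nat_pow nat_pow_circle_group)
  also have "\<dots> = 1"
    using assms(4) hom_one by (simp add: G.pow_order_eq_1 circle_group_def)
  finally have "h x ^ order G = 1" .
  moreover have "h x = 1 \<or> h x = -1"
    using assms(5) by (simp add: square_eq_1_iff)
  ultimately show ?thesis
    using assms(2) by auto
qed

theorem proposition4p14:
  fixes k :: nat and n :: "nat \<Rightarrow> nat"
    and v :: "(nat \<Rightarrow> int) \<Rightarrow> (nat \<Rightarrow> int) \<Rightarrow> complex"
  assumes n_pos: "\<And>i. i \<in> {1..k} \<Longrightarrow> n i > 0"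
    and n_odd: "\<And>i. i \<in> {1..k} \<Longrightarrow> odd (n i)"
    and v: "symmetric_bicharacter (cyclic_product k n) v"
  shows "\<forall>\<chi> \<in> bichar_Delta (cyclic_product k n) v. \<forall>\<eta> \<in> bichar_Delta (cyclic_product k n) v.
           v \<chi> \<eta> = 1 \<or> bichar_sym v \<chi> \<eta> \<noteq> 1"
proof (intro ballI)
  let ?\<Gamma> = "cyclic_product k n"
  fix \<chi> \<eta>
  assume "\<chi> \<in> bichar_Delta ?\<Gamma> v" "\<eta> \<in> bichar_Delta ?\<Gamma> v"
  then have \<chi>: "\<chi> \<in> carrier ?\<Gamma>" and \<eta>: "\<eta> \<in> carrier ?\<Gamma>"
    by (auto simp: bichar_Delta_def)
  have grp: "group ?\<Gamma>"
    using comm_group_cyclic_product by (simp add: comm_group_def)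
  \<comment> \<open>For \<open>k = 0\<close> the product is empty and the order is 1.\<close>
  have odd_order: "odd (order ?\<Gamma>)"
    using n_odd order_cyclic_product[of k n, OF n_pos] by (auto simp: even_prod_iff)
  have hom: "v \<chi> \<in> hom ?\<Gamma> circle_group" and sym: "v \<eta> \<chi> = v \<chi> \<eta>"
    using v \<chi> \<eta> by (auto simp: symmetric_bicharacter_def bicharacter_def)
  show "v \<chi> \<eta> = 1 \<or> bichar_sym v \<chi> \<eta> \<noteq> 1"
    \<comment> \<open>With \<open>sym\<close>, \<open>bichar_sym v \<chi> \<eta> = 1\<close> becomes
      the remaining premise \<open>h x * h x = 1\<close>, for \<open>h = v \<chi>\<close> and
      \<open>x = \<eta>\<close>.\<close>
    using hom_circle_group_eq_1_if_odd_order[OF grp odd_order hom \<eta>] sym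
    by (auto simp: bichar_sym_def)
qed

end
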